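(* Let $n\geq 2$ and let $l=3^m l_1$ be a positive integer with $l_1\geq 2$, $\gcd(3,l_1)=1$ and $m\geq 0$. Then $$\varepsilon(n,l)=\begin{cases} n^{3l}-n^l-\pi_n(3l) & \text{if } l_1 \text{ is odd},\\ n^{3l}+n^{l/2}\left(\pi_n(l)+1\right)-n^l-\pi_n(3l)-n^{3l/2} & \text{if } l_1 \text{ is even}.\end{cases}$$
   Context: A nonempty word $u$ is primitive if $u=v^m$ with $m$ a positive integer implies $m=1$; $|u|$ is the length of $u$. $\pi_n(k)$ denotes the number of primitive words of length $k$ over an alphabet of size $n$. $\varepsilon(n,l)$ is the number of pairs $(p,q)$ of primitive words over an alphabet of size $n$ with $|p|=2|q|=2l$ and $pq$ not primitive. *)

theory Defs
  imports Main
begin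

text \<open>Words are lists, and the power \<open>v\<^sup>m\<close> of a word is \<open>concat (replicate m v)\<close>.\<close>

definition primitive :: "'a list \<Rightarrow> bool" where
  "primitive u \<longleftrightarrow>
     u \<noteq> [] \<and> (\<forall>v m. m > 0 \<and> u = concat (replicate m v) \<longrightarrow> m = 1)"

text \<open>
  The numbers \<open>\<pi>\<^sub>n(k)\<close> and \<open>\<epsilon>(n,l)\<close> are taken over an arbitrary alphabet \<open>A\<close>;
  here \<open>n\<close> is the cardinality of \<open>A\<close>.
\<close>

definition primitive_count :: "'a set \<Rightarrow> nat \<Rightarrow> nat" where
  "primitive_count A k = card {u \<in> lists A. primitive u \<and> length u = k}"

definition eps :: "'a set \<Rightarrow> nat \<Rightarrow> nat" where
  "eps A l = card {(p, q). p \<in> lists A \<and> q \<in> lists A \<and> primitive p \<and> primitive q \<and>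
     length p = 2 * length q \<and> 2 * length q = 2 * l \<and> \<not> primitive (p @ q)}"

end

theory Submission
  imports Defs
begin

text \<open>
  Pairs \<open>(p, q)\<close> correspond to words \<open>w = pq\<close> of length \<open>3l\<close>, so \<open>\<epsilon>(n,l)\<close> counts the nonprimitive
  words \<open>w\<close> of length \<open>3l\<close> minus those for which \<open>p\<close> or \<open>q\<close> is nonprimitive. Let \<open>w = v\<^sup>k\<close> be of
  the latter kind. If \<open>3\<close> divides \<open>k\<close>, then \<open>w\<close> is a cube \<open>u\<^sup>3\<close> with \<open>|u| = l\<close>. Otherwise \<open>k\<close> is even or
  \<open>k \<ge> 5\<close>. A proper power \<open>p\<close>, or \<open>q\<close> in case \<open>k \<ge> 5\<close>, then has two periods to which the theorem of
  Fine and Wilf applies, and the resulting common period again makes \<open>w\<close> such a cube. The only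
  other exceptions are the words \<open>xqxq\<close> with \<open>|q| = 2|x| = l\<close> and \<open>q\<close> nonprimitive, which exist only for
  even \<open>l\<close>; such a word is a cube \<open>u\<^sup>3\<close> with \<open>|u| = l\<close> exactly when it is \<open>x\<^sup>6\<close>.
\<close>

section \<open>Periods and the theorem of Fine and Wilf\<close>

text \<open>Words enter as index functions \<open>(!) w\<close>, so that factors and infinite
  periodic sequences share one notion. \<open>d\<close> need not divide \<open>N\<close>.\<close>

definition period_on :: "(nat \<Rightarrow> 'a) \<Rightarrow> nat \<Rightarrow> nat \<Rightarrow> bool" where
  "period_on f N d \<longleftrightarrow> (\<forall>i. i + d < N \<longrightarrow> f (i + d) = f i)"

lemma period_on_mod:
  assumes "period_on f N d" "i < N"
  shows "f i = f (i mod d)"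
proof (cases "d = 0")
  case False
  then show ?thesis using assms(2)
  proof (induction i rule: less_induct)
    case (less i)
    show ?case
    proof (cases "i < d")
      case False
      then have "f (i - d) = f ((i - d) mod d)"
        using less by simp
      moreover have "f i = f (i - d)"
        using assms(1) False less.prems unfolding period_on_def
        by (metis le_add_diff_inverse2 linorder_not_less)
      ultimately show ?thesis using False by (simp add: le_mod_geq)
    qed simp
  qed
qed simp

lemma period_on_iff_mod:
  "period_on f N d \<longleftrightarrow> (\<forall>i<N. f i = f (i mod d))"
proof
  assume *: "\<forall>i<N. f i = f (i mod d)"
  show "period_on f N d"
    unfolding period_on_def
  proof (intro allI impI)
    fix i assume "i + d < N"
    then show "f (i + d) = f i" using *[rule_format, of i] *[rule_format, of "i + d"] by simp
  qed
qed (use period_on_mod in blast)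

lemma period_on_mono: "period_on f N d \<Longrightarrow> M \<le> N \<Longrightarrow> period_on f M d"
  by (auto simp: period_on_def)

lemma period_on_dvd:
  assumes "period_on f N d" "d dvd e"
  shows "period_on f N e"
proof -
  have "f (i + e) = f i" if "i + e < N" for i
  proof -
    have "(i + e) mod d = i mod d" using assms(2) by (metis mod_add_right_eq dvd_imp_mod_0 add.right_neutral)
    then show ?thesis
      using period_on_mod[OF assms(1), of i] period_on_mod[OF assms(1), of "i + e"] that by simp
  qed
  then show ?thesis by (simp add: period_on_def)
qed

text \<open>Reducing \<open>i\<close> modulo \<open>p\<close> lands inside the prefix of length
  \<open>M\<close>, and reducing further modulo \<open>d\<close> gives \<open>i mod d\<close>
  because \<open>d\<close> divides \<open>p\<close>.\<close>

lemma period_on_extend: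
  assumes "period_on f N p" "period_on f M d" "d dvd p" "0 < p" "p \<le> M"
  shows "period_on f N d"
  unfolding period_on_iff_mod
proof (intro allI impI)
  fix i assume "i < N"
  have "i mod p < M" using assms by (meson mod_less_divisor order_less_le_trans)
  then have "f (i mod p) = f (i mod p mod d)" by (rule period_on_mod[OF assms(2)])
  then show "f i = f (i mod d)"
    using period_on_mod[OF assms(1) \<open>i < N\<close>] assms(3) by (simp add: mod_mod_cancel)
qed

text \<open>Subtractive Euclid: for \<open>p < q\<close> the prefix of length \<open>N - p\<close>
  has periods \<open>p\<close> and \<open>q - p\<close>, with the same gcd, and since
  \<open>p <= N - p\<close> this common period spreads back to length \<open>N\<close>.\<close>

lemma fine_wilf:
  assumes "period_on f N p" "period_on f N q" "0 < p" "0 < q" "p + q \<le> N + gcd p q"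
  shows "period_on f N (gcd p q)"
  using assms
proof (induction "p + q" arbitrary: p q N rule: less_induct)
  case less
  \<comment> \<open>Own variables, with the induction hypothesis as a premise, let this serve both
    orders of the two periods.\<close>
  have step: "period_on f N (gcd p q)"
    if pq: "p < q" "0 < p" and P: "period_on f N p" and Q: "period_on f N q"
      and le: "p + q \<le> N + gcd p q" and len: "q < r"
      and IH: "\<And>p' q' N. p' + q' < r \<Longrightarrow> period_on f N p' \<Longrightarrow> period_on f N q' \<Longrightarrow> 0 < p' \<Longrightarrow> 0 < q'
        \<Longrightarrow> p' + q' \<le> N + gcd p' q' \<Longrightarrow> period_on f N (gcd p' q')" for p q r N
  proof -
    have g: "gcd p (q - p) = gcd p q"
      using pq by (metis gcd.commute gcd_diff1_nat less_imp_le)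
    have "gcd p q \<le> q - p" using g pq by (metis gcd_le2_nat zero_less_diff not_less0)
    have "period_on f (N - p) (q - p)"
      unfolding period_on_def
    proof (intro allI impI)
      fix i assume i: "i + (q - p) < N - p"
      then have "f (i + (q - p) + p) = f (i + (q - p))"
        using P unfolding period_on_def by (metis less_diff_conv)
      moreover have "f (i + q) = f i" using Q i unfolding period_on_def by simp
      ultimately show "f (i + (q - p)) = f i" using pq by simp
    qed
    moreover have "period_on f (N - p) p" using period_on_mono[OF P] by simp
    moreover have "p + (q - p) \<le> N - p + gcd p (q - p)" using pq le g \<open>gcd p q \<le> q - p\<close> by linarith
    ultimately have "period_on f (N - p) (gcd p (q - p))"
      using IH[of p "q - p"] pq len by simp
    moreover have "p \<le> N - p" using le \<open>gcd p q \<le> q - p\<close> pq by linarith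
    ultimately show ?thesis
      using period_on_extend[OF P, of "N - p" "gcd p q"] g pq by simp
  qed
  consider "p = q" | "p < q" | "q < p" by linarith
  then show ?case
  proof cases
    case 2
    show ?thesis by (rule step[OF 2 less.prems(3,1,2,5) _ less.hyps]) (use less.prems in auto)
  next
    case 3
    have "period_on f N (gcd q p)"
      by (rule step[OF 3 less.prems(4,2,1) _ _ less.hyps]) (use less.prems in \<open>auto simp: gcd.commute\<close>)
    then show ?thesis by (simp add: gcd.commute)
  qed (use less in simp)
qed

text \<open>Fine and Wilf inside one window suffices: the window holds a full period
  \<open>a\<close>, so the common period found there governs all of \<open>F\<close>.\<close>

lemma fine_wilf_window:
  assumes F: "\<And>i. F (i + a) = F i" and "0 < a" "0 < b" "a \<le> N"
    and "period_on (\<lambda>i. F (s + i)) N b" "a + b \<le> N + gcd a b"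
  shows "period_on F M (gcd a b)"
proof -
  let ?G = "\<lambda>i. F (s + i)" and ?d = "gcd a b"
  have aG: "period_on ?G K a" for K
    using F by (simp add: period_on_def flip: add.assoc)
  have "period_on ?G N ?d" using fine_wilf[OF aG assms(5)] assms by simp
  then have dG: "period_on ?G K ?d" for K
    using period_on_extend[OF aG] assms by simp
  have shift: "F i = F (i + s * a)" for i
  proof (induction s)
    case (Suc s)
    then show ?case using F[of "i + s * a"] by (simp add: algebra_simps)
  qed simp
  \<comment> \<open>A shift by \<open>s * a\<close> preserves \<open>F\<close> and moves every index
    past the start \<open>s\<close> of the window.\<close>
  have "s * a = s + s * (a - 1)"
    using \<open>0 < a\<close> by (cases a) auto
  then have "F i = ?G (i + s * (a - 1))" for i
    using shift[of i] by (simp add: algebra_simps)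
  moreover have "?G (i + s * (a - 1) + ?d) = ?G (i + s * (a - 1))" for i
    using dG[of "Suc (i + s * (a - 1) + ?d)"] by (simp add: period_on_def)
  ultimately show ?thesis unfolding period_on_def by (metis add.assoc add.commute)
qed

section \<open>Powers of words\<close>

lemma length_concat_replicate [simp]: "length (concat (replicate k v)) = k * length v"
  by (induction k) auto

lemma nth_concat_replicate:
  "i < k * length v \<Longrightarrow> concat (replicate k v) ! i = v ! (i mod length v)"
proof (induction k arbitrary: i)
  case (Suc k)
  then show ?case by (cases "i < length v") (auto simp: nth_append le_mod_geq)
qed simp

text \<open>Translates powers into periods; the base \<open>v\<close> is recovered as the prefix
  \<open>take d w\<close>.\<close>

lemma power_word_iff:
  assumes "length w = k * d" "0 < k"
  shows "(\<exists>v. length v = d \<and> w = concat (replicate k v)) \<longleftrightarrow> period_on ((!) w) (length w) d"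
proof
  assume "\<exists>v. length v = d \<and> w = concat (replicate k v)"
  then obtain v where v: "length v = d" "w = concat (replicate k v)" by blast
  show "period_on ((!) w) (length w) d"
    unfolding period_on_def
  proof (intro allI impI)
    fix i assume "i + d < length w"
    then show "w ! (i + d) = w ! i"
      using v assms by (simp add: nth_concat_replicate)
  qed
next
  assume *: "period_on ((!) w) (length w) d"
  have len: "length (take d w) = d" using assms by (cases k) auto
  have "w = concat (replicate k (take d w))"
  proof (rule nth_equalityI)
    fix i assume i: "i < length w"
    then have "0 < d" using assms by (cases d) auto
    then show "w ! i = concat (replicate k (take d w)) ! i"
      using i len assms period_on_mod[OF * i] by (simp add: nth_concat_replicate)
  qed (use len assms in simp)
  then show "\<exists>v. length v = d \<and> w = concat (replicate k v)" using len by blast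
qed

lemma not_primitiveE:
  assumes "\<not> primitive w" "length w = N" "0 < N"
  obtains k d where "2 \<le> k" "N = k * d" "period_on ((!) w) N d"
proof -
  obtain v k where v: "k > 0" "w = concat (replicate k v)" "k \<noteq> 1"
    using assms by (auto simp: primitive_def)
  moreover from this have "period_on ((!) w) (length w) (length v)"
    using power_word_iff[of w k "length v"] by auto
  ultimately show ?thesis
    using assms that[of k "length v"] by auto
qed

lemma not_primitive_square: "\<not> primitive (u @ u)"
proof -
  have "u @ u = concat (replicate 2 u)" by (simp add: numeral_2_eq_2)
  then show ?thesis unfolding primitive_def by (metis zero_less_numeral numeral_eq_one_iff semiring_norm(85))
qed

lemma not_primitive_cube: "\<not> primitive (u @ u @ u)"
proof -
  have "u @ u @ u = concat (replicate 3 u)" by (simp add: numeral_3_eq_3)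
  then show ?thesis unfolding primitive_def by (metis zero_less_numeral numeral_eq_one_iff semiring_norm(86))
qed

section \<open>Nonprimitive words with a nonprimitive factor\<close>

text \<open>The common period divides both \<open>3 * l\<close> and \<open>2 * l\<close>, hence
  their difference \<open>l\<close>. The hypothesis \<open>b dvd 2 * l\<close> covers both the
  prefix of length \<open>2 * l\<close> and the suffix of length \<open>l\<close>.\<close>

lemma cube_of_window:
  assumes w: "length w = 3 * l" and l: "0 < l"
    and a: "period_on ((!) w) (3 * l) a" "k * a = 3 * l"
    and win: "s + N \<le> 3 * l" "a \<le> N"
    and b: "period_on ((!) (take N (drop s w))) N b" "b dvd 2 * l" "a + b \<le> N + gcd a b"
  shows "\<exists>u. length u = l \<and> w = u @ u @ u"
proof -
  \<comment> \<open>The infinite \<open>a\<close>-periodic extension of \<open>w\<close>.\<close>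
  define F where "F i = w ! (i mod a)" for i
  have pos: "0 < a" "0 < b" using a(2) b(2) l by (auto intro: Nat.gr0I)
  have F: "w ! i = F i" if "i < 3 * l" for i
    using period_on_mod[OF a(1) that] by (simp add: F_def)
  have "period_on (\<lambda>i. F (s + i)) N b"
    unfolding period_on_def
  proof (intro allI impI)
    fix i assume i: "i + b < N"
    then have "take N (drop s w) ! (i + b) = take N (drop s w) ! i"
      using b(1) by (simp add: period_on_def)
    then show "F (s + (i + b)) = F (s + i)"
      using i win w F[of "s + (i + b)"] F[of "s + i"] by simp
  qed
  then have "period_on F (3 * l) (gcd a b)"
    using fine_wilf_window[of F a b N s] pos win b(3) by (simp add: F_def)
  moreover have "gcd a b dvd l"
  proof -
    have "gcd a b dvd 3 * l" by (metis a(2) dvd_mult gcd_dvd1)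
    moreover have "gcd a b dvd 2 * l" using b(2) by (meson dvd_trans gcd_dvd2)
    ultimately have "gcd a b dvd 3 * l - 2 * l" by (rule dvd_diff_nat)
    then show ?thesis by simp
  qed
  ultimately have "period_on F (3 * l) l" by (rule period_on_dvd)
  then have "period_on ((!) w) (length w) l" using F w by (simp add: period_on_def)
  then show ?thesis
    using power_word_iff[of w 3 l] w by (auto simp: numeral_3_eq_3)
qed

text \<open>An explicit common divisor \<open>t\<close> bounds the gcd from below, so the gcd itself
  need not be computed.\<close>

lemma add_le_gcdI:
  fixes a b N t :: nat
  assumes "t dvd a" "t dvd b" "0 < a" "a + b \<le> N + t"
  shows "a + b \<le> N + gcd a b"
proof -
  have "t dvd gcd a b" "0 < gcd a b" using assms by auto
  then have "t \<le> gcd a b" by (rule dvd_imp_le)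
  then show ?thesis using assms(4) by linarith
qed

text \<open>The gcd term in the bound of Fine and Wilf is needed in the next two lemmas only for
  small exponents (\<open>k = 5\<close>, \<open>j = 2\<close>, resp. \<open>k = 2\<close>, \<open>j \<le> 3\<close>), where the gcd is explicit.\<close>

lemma suffix_bound:
  fixes a b j k l :: nat
  assumes "k * a = 3 * l" "j * b = l" "5 \<le> k" "2 \<le> j" "0 < l"
  shows "a + b \<le> l + gcd a b"
proof (cases "k = 5 \<and> j = 2")
  case True
  \<comment> \<open>Here \<open>a = 3l/5\<close> and \<open>b = l/2\<close>, so
    \<open>a - b = l/10\<close> is exactly the excess of \<open>a + b\<close> over
    \<open>l\<close>.\<close>
  then have "a = 6 * (a - b)" "b = 5 * (a - b)" "0 < a" "a + b \<le> l + (a - b)"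
    using assms by auto
  then show ?thesis
      by (intro add_le_gcdI[of "a - b"]) (auto intro: dvdI[OF trans[OF _ mult.commute]])
next
  case False
  have "5 * a \<le> 3 * l" "2 * b \<le> l"
    using mult_le_mono1[OF assms(3), of a] mult_le_mono1[OF assms(4), of b] assms(1,2) by simp_all
  \<comment> \<open>Excluding the tight pair improves one of the two bounds, which brings the sum
    down to \<open>l\<close>.\<close>
  moreover have "6 * a \<le> 3 * l \<or> 3 * b \<le> l"
  proof (cases "k = 5")
    case True
    then have "3 \<le> j" using False assms by auto
    then show ?thesis using mult_le_mono1[of 3 j b] assms(2) by simp
  next
    case False
    then have "6 \<le> k" using assms by auto
    then show ?thesis using mult_le_mono1[of 6 k a] assms(1) by simp
  qed
  ultimately have "a + b \<le> l" by linarith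
  then show ?thesis by simp
qed

lemma prefix_bound:
  fixes a b j k l :: nat
  assumes "k * a = 3 * l" "j * b = 2 * l" "k = 2 \<or> 5 \<le> k" "2 \<le> j" "0 < l"
  shows "a + b \<le> 2 * l + gcd a b"
proof -
  have j: "2 * b \<le> 2 * l" using mult_le_mono1[OF assms(4), of b] assms(2) by simp
  consider "5 \<le> k" | "k = 2" "j = 2" | "k = 2" "j = 3" | "k = 2" "4 \<le> j"
    using assms by linarith
  then show ?thesis
  proof cases
    case 1
    then have "5 * a \<le> 3 * l" using mult_le_mono1[of 5 k a] assms(1) by simp
    then have "a + b \<le> 2 * l" using j by linarith
    then show ?thesis by simp
  next
    case 2
    then have "a = 3 * (a - b)" "b = 2 * (a - b)" "0 < a" "a + b \<le> 2 * l + (a - b)"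
      using assms by auto
    then show ?thesis
      by (intro add_le_gcdI[of "a - b"]) (auto intro: dvdI[OF trans[OF _ mult.commute]])
  next
    case 3
    \<comment> \<open>Here \<open>a = 3l/2\<close> and \<open>b = 2l/3\<close>, so
      \<open>a - 2 * b = l/6\<close> is again exactly the excess.\<close>
    then have "a = 9 * (a - 2 * b)" "b = 4 * (a - 2 * b)" "0 < a" "a + b \<le> 2 * l + (a - 2 * b)"
      using assms by auto
    then show ?thesis
      by (intro add_le_gcdI[of "a - 2 * b"]) (auto intro: dvdI[OF trans[OF _ mult.commute]])
  next
    case 4
    then have "4 * b \<le> 2 * l" using mult_le_mono1[of 4 j b] assms(2) by simp
    moreover have "2 * a = 3 * l" using assms(1) 4 by simp
    ultimately have "a + b \<le> 2 * l" by linarith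
    then show ?thesis by simp
  qed
qed

text \<open>Once cubes are excluded, the exponent is either even, so that \<open>w\<close> is a
  square and only its suffix can be a proper power, or at least 5, where both alternatives are
  contradictory.\<close>

lemma nonprimitive_cases:
  assumes w: "length w = 3 * l" "0 < l" and np: "\<not> primitive w"
    and bad: "\<not> primitive (take (2 * l) w) \<or> \<not> primitive (drop (2 * l) w)"
    and not_cube: "\<nexists>u. length u = l \<and> w = u @ u @ u"
  shows "\<exists>x q. 2 * length x = l \<and> length q = l \<and> \<not> primitive q \<and> w = x @ q @ x @ q"
proof -
  obtain k a where k: "2 \<le> k" "3 * l = k * a" "period_on ((!) w) (3 * l) a"
    by (rule not_primitiveE[OF np w(1)]) (use w(2) in simp)
  have pow: "\<exists>v. w = concat (replicate r v) \<and> 3 * l = r * length v" if "r dvd k" "0 < r" for r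
  proof -
    from that(1) obtain c where c: "k = r * c" by (elim dvdE)
    have "period_on ((!) w) (length w) (c * a)" using k(3) w by (simp add: period_on_dvd)
    then show ?thesis using power_word_iff[of w r "c * a"] c k that w by auto
  qed
  have "\<not> 3 dvd k"
  proof
    assume "3 dvd k"
    then obtain v where "w = concat (replicate 3 v)" "3 * l = 3 * length v" using pow[of 3] by auto
    then have "length v = l" "w = v @ v @ v" by (simp_all add: numeral_3_eq_3)
    then show False using not_cube by blast
  qed
  \<comment> \<open>The exponent is kept general: even \<open>k\<close> uses it with exponent 2 and
    period \<open>3l/2\<close>, odd \<open>k\<close> with \<open>k\<close> and \<open>a\<close>
    themselves.\<close>
  have prefix: False if "\<not> primitive (take (2 * l) w)" "k' * a' = 3 * l" "k' = 2 \<or> 5 \<le> k'"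
    "period_on ((!) w) (3 * l) a'" for k' a'
  proof -
    obtain j b where j: "2 \<le> j" "2 * l = j * b" "period_on ((!) (take (2 * l) w)) (2 * l) b"
      by (rule not_primitiveE[OF \<open>\<not> primitive (take (2 * l) w)\<close>, of "2 * l"]) (use w in auto)
    have "2 \<le> k'" using that(3) by linarith
    then have "2 * a' \<le> 3 * l" using mult_le_mono1[of 2 k' a'] that(2) by simp
    then have a': "a' \<le> 2 * l" by linarith
    have "period_on ((!) (take (2 * l) (drop 0 w))) (2 * l) b" using j(3) by simp
    moreover have "b dvd 2 * l" by (simp only: j(2) dvd_triv_right)
    moreover have "a' + b \<le> 2 * l + gcd a' b"
      by (rule prefix_bound[OF that(2) j(2)[symmetric] that(3) j(1) w(2)])
    ultimately show False
      using cube_of_window[OF w that(4,2) _ a', of 0 b] not_cube by simp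
  qed
  show ?thesis
  proof (cases "even k")
    case True
    then obtain v where v: "w = concat (replicate 2 v)" "3 * l = 2 * length v" using pow[of 2] by auto
    then have "period_on ((!) w) (3 * l) (length v)"
      using power_word_iff[of w 2 "length v"] w by auto
    then have "\<not> primitive (drop (2 * l) w)"
      using prefix[of 2 "length v"] v(2)[symmetric] bad by blast
    have vv: "w = v @ v" using v by (simp add: numeral_2_eq_2)
    have "even l" using v(2) by presburger
    then obtain h where h: "l = 2 * h" by (elim evenE)
    then have lv: "length v = 3 * h" using v(2) by simp
    \<comment> \<open>Cutting the root \<open>v\<close> after its first third makes \<open>q\<close>
      the last \<open>l\<close> letters of \<open>w\<close>.\<close>
    define x q where "x = take h v" and "q = drop h v"
    then have "v = x @ q" "2 * length x = l" "length q = l" "drop (2 * l) w = q"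
      using h lv vv by auto
    then show ?thesis using vv \<open>\<not> primitive (drop (2 * l) w)\<close>
      by (intro exI[of _ x] exI[of _ q]) simp
  next
    case False
    then have "5 \<le> k" using k(1) \<open>\<not> 3 dvd k\<close>
      by (cases "k = 2"; cases "k = 3"; cases "k = 4") auto
    then have "\<not> primitive (drop (2 * l) w)"
      using prefix[OF _ k(2)[symmetric] _ k(3)] bad by blast
    then obtain j b where j: "2 \<le> j" "l = j * b" "period_on ((!) (drop (2 * l) w)) l b"
      by (rule not_primitiveE[of "drop (2 * l) w" l]) (use w in auto)
    have "5 * a \<le> 3 * l" using mult_le_mono1[OF \<open>5 \<le> k\<close>, of a] k(2) by simp
    then have "a \<le> l" by linarith
    moreover have "period_on ((!) (take l (drop (2 * l) w))) l b" using j(3) w(1) by simp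
    moreover have "b dvd 2 * l" using j(2) by (metis dvd_mult dvd_triv_right)
    moreover have "a + b \<le> l + gcd a b"
      by (rule suffix_bound[OF k(2)[symmetric] j(2)[symmetric] \<open>5 \<le> k\<close> j(1) w(2)])
    ultimately show ?thesis
      using cube_of_window[OF w k(3) k(2)[symmetric], of "2 * l" l b] not_cube by simp
  qed
qed

section \<open>Counting\<close>

abbreviation words :: "'a set \<Rightarrow> nat \<Rightarrow> 'a list set" where
  "words A k \<equiv> {w \<in> lists A. length w = k}"

lemma finite_words: "finite A \<Longrightarrow> finite (words A k)"
  using finite_lists_length_eq[of A k] by (simp add: lists_eq_set)

lemma card_words: "finite A \<Longrightarrow> card (words A k) = card A ^ k"
  using card_lists_length_eq[of A k] by (simp add: lists_eq_set)

lemma int_card_Diff: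
  "finite B \<Longrightarrow> C \<subseteq> B \<Longrightarrow> int (card (B - C)) = int (card B) - int (card C)"
  by (simp add: card_Diff_subset card_mono finite_subset of_nat_diff)

lemma card_nonprimitive:
  assumes "finite A"
  shows "int (card {w \<in> words A k. \<not> primitive w}) = int (card A) ^ k - int (primitive_count A k)"
proof -
  have "{w \<in> words A k. \<not> primitive w} = words A k - {u \<in> lists A. primitive u \<and> length u = k}"
    by auto
  moreover have "{u \<in> lists A. primitive u \<and> length u = k} \<subseteq> words A k" by auto
  ultimately show ?thesis
    by (simp only: int_card_Diff[OF finite_words[OF assms]] card_words[OF assms] of_nat_power
        primitive_count_def)
qed

definition bad_words :: "'a set \<Rightarrow> nat \<Rightarrow> 'a list set" where
  "bad_words A l = {w \<in> words A (3 * l). \<not> primitive w \<and>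
      (\<not> primitive (take (2 * l) w) \<or> \<not> primitive (drop (2 * l) w))}"

definition cubes :: "'a set \<Rightarrow> nat \<Rightarrow> 'a list set" where
  "cubes A l = (\<lambda>u. u @ u @ u) ` words A l"

text \<open>The exceptional squares \<open>(xq)(xq)\<close>. Their length is \<open>3 * l\<close>
  only for even \<open>l\<close>; for odd \<open>l\<close> the division rounds down.\<close>

definition np_squares :: "'a set \<Rightarrow> nat \<Rightarrow> 'a list set" where
  "np_squares A l = (\<lambda>(x, q). x @ q @ x @ q) ` (words A (l div 2) \<times> {q \<in> words A l. \<not> primitive q})"

text \<open>Concatenation is injective on the counted pairs, as cutting at \<open>2 * l\<close>
  undoes it; its image is the set of nonprimitive words that are not bad.\<close>

lemma eps_bad_words:
  assumes A: "finite A" and l: "0 < l"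
  shows "int (eps A l) =
    int (card A) ^ (3 * l) - int (primitive_count A (3 * l)) - int (card (bad_words A l))"
proof -
  let ?N = "{w \<in> words A (3 * l). \<not> primitive w}"
  let ?E = "{(p, q). p \<in> lists A \<and> q \<in> lists A \<and> primitive p \<and> primitive q \<and>
     length p = 2 * length q \<and> 2 * length q = 2 * l \<and> \<not> primitive (p @ q)}"
  have "bij_betw (\<lambda>(p, q). p @ q) ?E (?N - bad_words A l)"
    by (rule bij_betw_byWitness[where f' = "\<lambda>w. (take (2 * l) w, drop (2 * l) w)"])
      (auto simp: bad_words_def dest: in_set_takeD in_set_dropD)
  then have "eps A l = card (?N - bad_words A l)" unfolding eps_def by (rule bij_betw_same_card)
  moreover have "int (card (?N - bad_words A l)) = int (card ?N) - int (card (bad_words A l))"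
  proof (rule int_card_Diff)
    show "finite ?N" by (rule finite_subset[OF _ finite_words[OF A, of "3 * l"]]) auto
  qed (auto simp: bad_words_def)
  ultimately show ?thesis by (simp only: card_nonprimitive[OF A])
qed

lemma cubes_subset_bad_words: "cubes A l \<subseteq> bad_words A l"
proof
  fix w assume "w \<in> cubes A l"
  then obtain u where "u \<in> words A l" "w = u @ u @ u" by (auto simp: cubes_def)
  moreover from this have "take (2 * l) w = u @ u" by simp
  ultimately show "w \<in> bad_words A l"
    using not_primitive_square[of u] not_primitive_cube[of u] by (auto simp: bad_words_def)
qed

lemma np_squares_subset_bad_words:
  assumes "even l"
  shows "np_squares A l \<subseteq> bad_words A l"
proof
  fix w assume "w \<in> np_squares A l"
  then obtain x q where xq: "x \<in> words A (l div 2)" "q \<in> words A l" "\<not> primitive q"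
    "w = x @ q @ x @ q" by (auto simp: np_squares_def)
  moreover from this assms have "drop (2 * l) w = q" by auto
  ultimately show "w \<in> bad_words A l"
    using not_primitive_square[of "x @ q"] assms by (auto simp: bad_words_def)
qed

lemma bad_words_subset:
  assumes "0 < l"
  shows "bad_words A l \<subseteq> cubes A l \<union> (if even l then np_squares A l else {})"
proof
  fix w assume w: "w \<in> bad_words A l"
  show "w \<in> cubes A l \<union> (if even l then np_squares A l else {})"
  proof (cases "\<exists>u. length u = l \<and> w = u @ u @ u")
    case True
    then show ?thesis using w by (auto simp: cubes_def bad_words_def)
  next
    case False
    then obtain x q where xq: "2 * length x = l" "length q = l" "\<not> primitive q" "w = x @ q @ x @ q"
      using nonprimitive_cases[of w l] assms w by (auto simp: bad_words_def)
    then have "(x, q) \<in> words A (l div 2) \<times> {q \<in> words A l. \<not> primitive q}"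
      using w by (auto simp: bad_words_def)
    moreover have "even l" using xq(1) by presburger
    ultimately show ?thesis using xq(4) unfolding np_squares_def by force
  qed
qed

lemma card_cubes: "finite A \<Longrightarrow> card (cubes A l) = card A ^ l"
  unfolding cubes_def by (subst card_image) (auto simp: inj_on_def card_words)

lemma card_np_squares:
  assumes "finite A"
  shows "int (card (np_squares A l)) =
    int (card A) ^ (l div 2) * (int (card A) ^ l - int (primitive_count A l))"
proof -
  have "inj_on (\<lambda>(x, q). x @ q @ x @ q) (words A (l div 2) \<times> {q \<in> words A l. \<not> primitive q})"
    by (auto simp: inj_on_def)
  then show ?thesis
    unfolding np_squares_def
    by (simp only: card_image card_cartesian_product of_nat_mult card_nonprimitive[OF assms]
        card_words[OF assms] of_nat_power)
qed

lemma cubes_Int_np_squares: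
  assumes "even l"
  shows "cubes A l \<inter> np_squares A l = (\<lambda>x. x @ x @ x @ x @ x @ x) ` words A (l div 2)"
proof (intro equalityI subsetI)
  fix w assume w: "w \<in> cubes A l \<inter> np_squares A l"
  then obtain u where u: "u \<in> words A l" "w = u @ u @ u" by (auto simp: cubes_def)
  obtain x q where x: "x \<in> words A (l div 2)" "q \<in> words A l" "w = x @ q @ x @ q"
    using w by (auto simp: np_squares_def)
  define y z where "y = take (l div 2) u" and "z = drop (l div 2) u"
  have yz: "u = y @ z" "length y = l div 2" "length z = l div 2"
    using u assms by (auto simp: y_def z_def)
  \<comment> \<open>With \<open>u\<close> halved into \<open>y\<close> and \<open>z\<close>, the six
    half-blocks of the cube are grouped to match \<open>x\<close>, \<open>q\<close>,
    \<open>x\<close>, \<open>q\<close>; this forces \<open>y = x\<close> and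
    \<open>z = x\<close>.\<close>
  have eq: "y @ (z @ y) @ z @ y @ z = x @ q @ x @ q"
    unfolding x(3)[symmetric] u(2) yz(1) by (simp only: append_assoc)
  have len: "length y = length x" "length (z @ y) = length q" "length z = length x"
    using x yz assms by auto
  note append_inj = append_eq_append_conv[THEN iffD1, OF disjI1]
  have "y = x" using append_inj[OF len(1) eq] by blast
  have "z @ y @ z = x @ q"
    using append_inj[OF len(2), of "z @ y @ z" "x @ q"] append_inj[OF len(1) eq] by auto
  then have "z = x" using append_inj[OF len(3)] by blast
  then show "w \<in> (\<lambda>x. x @ x @ x @ x @ x @ x) ` words A (l div 2)"
    using u yz x \<open>y = x\<close> \<open>z = x\<close> by auto
next
  fix w assume "w \<in> (\<lambda>x. x @ x @ x @ x @ x @ x) ` words A (l div 2)"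
  then obtain x where x: "x \<in> words A (l div 2)" "w = x @ x @ x @ x @ x @ x" by auto
  \<comment> \<open>The word \<open>x @ x\<close> serves both as the root of the cube and as the
    nonprimitive \<open>q\<close>.\<close>
  then have "x @ x \<in> words A l" using assms by auto
  then show "w \<in> cubes A l \<inter> np_squares A l"
    using x not_primitive_square[of x] unfolding cubes_def np_squares_def
    by (auto intro!: image_eqI[of _ _ "x @ x"] image_eqI[of _ _ "(x, x @ x)"])
qed

lemma card_bad_words_odd:
  assumes "finite A" "odd l"
  shows "card (bad_words A l) = card A ^ l"
proof -
  have "bad_words A l = cubes A l"
    using bad_words_subset[of l A] cubes_subset_bad_words[of A l] assms(2) by (auto simp: odd_pos)
  then show ?thesis using card_cubes assms by simp
qed

text \<open>Inclusion-exclusion; the last term counts the sixth powers lying in both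
  families.\<close>

lemma card_bad_words_even:
  assumes A: "finite A" and l: "even l" "0 < l"
  shows "int (card (bad_words A l)) = int (card A) ^ l
    + int (card A) ^ (l div 2) * (int (card A) ^ l - int (primitive_count A l))
    - int (card A) ^ (l div 2)"
proof -
  have eq: "bad_words A l = cubes A l \<union> np_squares A l"
    using bad_words_subset[OF l(2), of A] cubes_subset_bad_words[of A l]
      np_squares_subset_bad_words[OF l(1), of A] l(1) by auto
  have "finite (bad_words A l)"
    by (rule finite_subset[OF _ finite_words[OF A, of "3 * l"]]) (auto simp: bad_words_def)
  then have "card (cubes A l) + card (np_squares A l)
      = card (bad_words A l) + card (cubes A l \<inter> np_squares A l)"
    unfolding eq by (intro card_Un_Int) auto
  moreover have "card (cubes A l \<inter> np_squares A l) = card A ^ (l div 2)"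
    unfolding cubes_Int_np_squares[OF l(1)]
    by (subst card_image) (auto simp: inj_on_def card_words A)
  ultimately have "int (card A) ^ l + int (card (np_squares A l))
      = int (card (bad_words A l)) + int (card A) ^ (l div 2)"
    using card_cubes[OF A, of l] by (metis of_nat_add of_nat_power)
  then show ?thesis using card_np_squares[OF A, of l] by linarith
qed

theorem theorem3p12:
  fixes A :: "'a set" and n l l1 m :: nat
  assumes "finite A" and "card A = n" and "n \<ge> 2"
    and "l > 0" and "l = 3 ^ m * l1" and "l1 \<ge> 2" and "gcd 3 l1 = 1"
  shows "int (eps A l) =
    (if odd l1 then
       int n ^ (3 * l) - int n ^ l - int (primitive_count A (3 * l))
     else
       int n ^ (3 * l) + int n ^ (l div 2) * (int (primitive_count A l) + 1)
         - int n ^ l - int (primitive_count A (3 * l)) - int n ^ (3 * l div 2))"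
proof (cases "odd l1")
  case True
  \<comment> \<open>The factor \<open>3 ^ m\<close> is odd, so \<open>l\<close> and
    \<open>l1\<close> have the same parity.\<close>
  then have "odd l" using assms by simp
  then show ?thesis
    using True eps_bad_words[of A l] card_bad_words_odd[of A l] assms by simp
next
  case False
  then have l: "even l" using assms by simp
  then obtain h where h: "l = 2 * h" by blast
  \<comment> \<open>This product, from the expanded count of exceptional squares, is the last term
    of the even formula.\<close>
  have "int n ^ (l div 2) * int n ^ l = int n ^ (3 * l div 2)"
    using h by (simp flip: power_add)
  moreover have "int (eps A l) = int n ^ (3 * l) - int (primitive_count A (3 * l)) - (int n ^ l
      + int n ^ (l div 2) * (int n ^ l - int (primitive_count A l)) - int n ^ (l div 2))"
    using eps_bad_words[of A l] card_bad_words_even[of A l] assms l by simp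
  ultimately show ?thesis
    using False by (simp add: algebra_simps)
qed

end
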